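(* Let $G=(\mathcal V,\mathcal E)$ be a finite undirected graph with finite label sets and potentials $\theta$. For a test labeling $x^0\in X_{\mathcal V}$ let $\psi$ be the reparametrization $$\psi_{v,u}(x_v)=-\theta_{uv}(x^0_u,x_v)\quad\text{for all } uv\in\mathcal E\ \text{(both orientations)},\ x_v\in X_v .$$ For a reparametrization $\varphi$ let $A^{\varphi,\ast}_{x^0}$ be the largest set containing all strongly persistent variables satisfying the relaxed criterion with respect to the reparametrized potentials $\theta^\varphi$ and the test labeling $x^0$, and let $A^{\ast}_{x^0}$ correspond to the trivial reparametrization $\varphi\equiv0$. Then for any test labeling $x^0\in X_{\mathcal V}$ there holds $A^{\ast}_{x^0}\subset A^{\psi,\ast}_{x^0}$.
   Context: For $A\subset\mathcal V$, $X_A=\prod_{v\in A}X_v$, where $X_v$ is the finite label set of node $v$; $\theta_u:X_u\to\mathbb R$ and $\theta_{uv}:X_u\times X_v\to\mathbb R$ are the unary and pairwise potentials (edges are undirected, so $\theta_{uv}(x_u,x_v)$ and $\theta_{vu}(x_v,x_u)$ denote the same number). $E_A(x)=\sum_{u\in A}\theta_u(x_u)+\sum_{uv\in\mathcal E:\,u,v\in A}\theta_{uv}(x_u,x_v)$. Boundary nodes: $\partial\mathcal V_A=\{u\in A:\exists v\in\mathcal V\setminus A,\ uv\in\mathcal E\}$; boundary edges: $\partial\mathcal E_A=\{uv\in\mathcal E:u\in A,\ v\in\mathcal V\setminus A\}$. For $uv\in\partial\mathcal E_A$ with $u\in\partial\mathcal V_A$ and a test label $y_u$: $\hat\theta_{uv,y_u}(x_u)=\max_{x_v\in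 X_v}\theta_{uv}(x_u,x_v)$ if $x_u=y_u$, and $\hat\theta_{uv,y_u}(x_u)=\min_{x_v\in X_v}\theta_{uv}(x_u,x_v)$ if $x_u\neq y_u$. $\hat E_{A,y}(x)=E_A(x)+\sum_{uv\in\partial\mathcal E_A:\,u\in\partial\mathcal V_A}\hat\theta_{uv,y_u}(x_u)$ (only the restriction of $y$ to $\partial\mathcal V_A$ matters). The local polytope $\Lambda_A$ is the set of nonnegative vectors $\mu$ with components $\mu_v(x_v)$ ($v\in A$, $x_v\in X_v$) and $\mu_{uv}(x_u,x_v)$ ($uv\in\mathcal E$, $u,v\in A$) such that $\sum_{x_v\in X_v}\mu_v(x_v)=1$, $\sum_{x_v\in X_v}\mu_{uv}(x_u,x_v)=\mu_u(x_u)$ and $\sum_{x_u\in X_u}\mu_{uv}(x_u,x_v)=\mu_v(x_v)$. For $x\in X_A$, $\delta(x)\in\Lambda_A$ is its indicator vector. Energies that are sums of unary and pairwise terms are extended linearly to $\Lambda_A$ (each $f_v$ becomes $\sum_{x_v}f_v(x_v)\mu_v(x_v)$, each $f_{uv}$ becomes $\sum_{x_u,x_v}f_{uv}(x_u,x_v)\mu_{uv}(x_u,x_v)$). A reparametrization is a vector $\varphi$ of reals $\varphi_{v,u}(x_v)$ (for every edge $uv$, both orientations, $x_v\in X_v$); the reparametrized potentials are $\theta^\varphi_v(x_v)=\theta_v(x_v)-\sum_{u:\,uv\in\mathcal E}\varphi_{v,u}(x_v)$ and $\theta^\varphi_{uv}(x_u,x_v)=\theta_{uv}(x_u,x_v)+\varphi_{v,u}(x_v)+\varphi_{u,v}(x_u)$.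 $\hat E^\varphi_{A,y}$ denotes $\hat E_{A,y}$ constructed from $\theta^\varphi$ instead of $\theta$. Relaxed criterion with respect to $\theta^\varphi$ and test labeling $x^0$ on a set $A$: $\delta(x^0|_A)\in\operatorname{arg\,min}_{\mu\in\Lambda_A}\hat E^\varphi_{A,x^0|_A}(\mu)$. A labeling $x^\ast\in X_A$ is strongly persistent on $A$ (with respect to $\theta^\varphi$) if $x'\in\operatorname{arg\,min}_{x\in X_A}\hat E^\varphi_{A,x'}(x)$ implies $x'=x^\ast$, i.e. $x^\ast$ is the unique labeling on $A$ such that $x^\ast\in\operatorname{arg\,min}_{x\in X_A}\hat E^\varphi_{A,x^\ast}(x)$. The strongly persistent variables satisfying the relaxed criterion are the nodes of sets $A$ on which $x^0|_A$ satisfies the relaxed criterion and is strongly persistent. *)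

theory Defs
  imports Complex_Main "HOL-Library.FuncSet"
begin

(* An undirected edge uv is represented by the two arcs (u, v) and (v, u). *)
record ('v, 'l) label_graph =
  nodes :: "'v set"
  edges :: "('v \<times> 'v) set"
  labels :: "'v \<Rightarrow> 'l set"

definition wf_label_graph :: "('v, 'l) label_graph \<Rightarrow> bool" where
  "wf_label_graph G \<longleftrightarrow>
     finite (nodes G) \<and> edges G \<subseteq> nodes G \<times> nodes G \<and> sym (edges G) \<and> irrefl (edges G) \<and>
     (\<forall>v\<in>nodes G. finite (labels G v))"

definition labelings :: "('v, 'l) label_graph \<Rightarrow> 'v set \<Rightarrow> ('v \<Rightarrow> 'l) set" where
  "labelings G A = Pi\<^sub>E A (labels G)"

(* Used both for potentials theta and for relaxed labelings mu. Only components at nodes, edges and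
   admissible labels carry meaning; all other values are unconstrained and never evaluated. *)
record ('v, 'l) pvec =
  unary :: "'v \<Rightarrow> 'l \<Rightarrow> real"
  pairwise :: "'v \<Rightarrow> 'v \<Rightarrow> 'l \<Rightarrow> 'l \<Rightarrow> real"

definition inner_edges :: "('v, 'l) label_graph \<Rightarrow> 'v set \<Rightarrow> ('v \<times> 'v) set" where
  "inner_edges G A = {(u, v) \<in> edges G. u \<in> A \<and> v \<in> A}"

(* Each boundary edge occurs once, directed from its end in A to its end outside A. *)
definition boundary_edges :: "('v, 'l) label_graph \<Rightarrow> 'v set \<Rightarrow> ('v \<times> 'v) set" where
  "boundary_edges G A = {(u, v) \<in> edges G. u \<in> A \<and> v \<in> nodes G - A}"

(* The two orientations of an edge name the same number. *)
definition orientation_invariant ::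
    "('v, 'l) label_graph \<Rightarrow> 'v set \<Rightarrow> ('v, 'l) pvec \<Rightarrow> bool" where
  "orientation_invariant G A f \<longleftrightarrow>
     (\<forall>(u, v)\<in>inner_edges G A. \<forall>a\<in>labels G u. \<forall>b\<in>labels G v.
        pairwise f u v a b = pairwise f v u b a)"

(* The factor 1/2 compensates for every inner edge being visited in both orientations. *)
definition energy ::
    "('v, 'l) label_graph \<Rightarrow> ('v, 'l) pvec \<Rightarrow> 'v set \<Rightarrow> ('v \<Rightarrow> 'l) \<Rightarrow> real" where
  "energy G \<theta> A x =
     (\<Sum>u\<in>A. unary \<theta> u (x u)) +
     (\<Sum>(u, v)\<in>inner_edges G A. pairwise \<theta> u v (x u) (x v)) / 2"

definition theta_hat ::
    "('v, 'l) label_graph \<Rightarrow> ('v, 'l) pvec \<Rightarrow> 'v \<Rightarrow> 'v \<Rightarrow> 'l \<Rightarrow> 'l \<Rightarrow> real" where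
  "theta_hat G \<theta> u v y\<^sub>u x\<^sub>u =
     (if x\<^sub>u = y\<^sub>u then Max ((\<lambda>x\<^sub>v. pairwise \<theta> u v x\<^sub>u x\<^sub>v) ` labels G v)
      else Min ((\<lambda>x\<^sub>v. pairwise \<theta> u v x\<^sub>u x\<^sub>v) ` labels G v))"

definition energy_hat ::
    "('v, 'l) label_graph \<Rightarrow> ('v, 'l) pvec \<Rightarrow> 'v set \<Rightarrow> ('v \<Rightarrow> 'l) \<Rightarrow> ('v \<Rightarrow> 'l) \<Rightarrow> real" where
  "energy_hat G \<theta> A y x =
     energy G \<theta> A x + (\<Sum>(u, v)\<in>boundary_edges G A. theta_hat G \<theta> u v (y u) (x u))"

definition local_polytope :: "('v, 'l) label_graph \<Rightarrow> 'v set \<Rightarrow> ('v, 'l) pvec set" where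
  "local_polytope G A = {\<mu>.
     orientation_invariant G A \<mu> \<and>
     (\<forall>v\<in>A. \<forall>a\<in>labels G v. unary \<mu> v a \<ge> 0) \<and>
     (\<forall>(u, v)\<in>inner_edges G A. \<forall>a\<in>labels G u. \<forall>b\<in>labels G v. pairwise \<mu> u v a b \<ge> 0) \<and>
     (\<forall>v\<in>A. (\<Sum>a\<in>labels G v. unary \<mu> v a) = 1) \<and>
     (\<forall>(u, v)\<in>inner_edges G A. \<forall>a\<in>labels G u.
        (\<Sum>b\<in>labels G v. pairwise \<mu> u v a b) = unary \<mu> u a) \<and>
     (\<forall>(u, v)\<in>inner_edges G A. \<forall>b\<in>labels G v.
        (\<Sum>a\<in>labels G u. pairwise \<mu> u v a b) = unary \<mu> v b)}"

definition indicator_vec :: "('v \<Rightarrow> 'l) \<Rightarrow> ('v, 'l) pvec" where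
  "indicator_vec x =
     \<lparr>unary = (\<lambda>v a. of_bool (x v = a)),
      pairwise = (\<lambda>u v a b. of_bool (x u = a \<and> x v = b))\<rparr>"

definition relaxed_energy ::
    "('v, 'l) label_graph \<Rightarrow> ('v, 'l) pvec \<Rightarrow> 'v set \<Rightarrow> ('v, 'l) pvec \<Rightarrow> real" where
  "relaxed_energy G \<theta> A \<mu> =
     (\<Sum>u\<in>A. \<Sum>a\<in>labels G u. unary \<theta> u a * unary \<mu> u a) +
     (\<Sum>(u, v)\<in>inner_edges G A. \<Sum>a\<in>labels G u. \<Sum>b\<in>labels G v.
        pairwise \<theta> u v a b * pairwise \<mu> u v a b) / 2"

definition relaxed_energy_hat ::
    "('v, 'l) label_graph \<Rightarrow> ('v, 'l) pvec \<Rightarrow> 'v set \<Rightarrow> ('v \<Rightarrow> 'l) \<Rightarrow> ('v, 'l) pvec \<Rightarrow> real" where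
  "relaxed_energy_hat G \<theta> A y \<mu> =
     relaxed_energy G \<theta> A \<mu> +
     (\<Sum>(u, v)\<in>boundary_edges G A. \<Sum>a\<in>labels G u. theta_hat G \<theta> u v (y u) a * unary \<mu> u a)"

(* The argument order of \<phi> is \<phi> v u a for the value at the end v of the edge uv. *)
definition reparametrize ::
    "('v, 'l) label_graph \<Rightarrow> ('v \<Rightarrow> 'v \<Rightarrow> 'l \<Rightarrow> real) \<Rightarrow> ('v, 'l) pvec \<Rightarrow> ('v, 'l) pvec" where
  "reparametrize G \<phi> \<theta> =
     \<lparr>unary = (\<lambda>v a. unary \<theta> v a - (\<Sum>u | (u, v) \<in> edges G. \<phi> v u a)),
      pairwise = (\<lambda>u v a b. pairwise \<theta> u v a b + \<phi> v u b + \<phi> u v a)\<rparr>"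

definition relaxed_criterion ::
    "('v, 'l) label_graph \<Rightarrow> ('v, 'l) pvec \<Rightarrow> ('v \<Rightarrow> 'l) \<Rightarrow> 'v set \<Rightarrow> bool" where
  "relaxed_criterion G \<theta> x\<^sub>0 A \<longleftrightarrow>
     is_arg_min (relaxed_energy_hat G \<theta> A (restrict x\<^sub>0 A)) (\<lambda>\<mu>. \<mu> \<in> local_polytope G A)
       (indicator_vec (restrict x\<^sub>0 A))"

definition strongly_persistent ::
    "('v, 'l) label_graph \<Rightarrow> ('v, 'l) pvec \<Rightarrow> 'v set \<Rightarrow> ('v \<Rightarrow> 'l) \<Rightarrow> bool" where
  "strongly_persistent G \<theta> A x \<longleftrightarrow>
     (\<forall>x'. is_arg_min (energy_hat G \<theta> A x') (\<lambda>z. z \<in> labelings G A) x' \<longleftrightarrow> x' = x)"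

(* The set of all strongly persistent variables: the union of all node sets on which the test
   labeling satisfies the relaxed criterion and is strongly persistent. *)
definition persistent_variables ::
    "('v, 'l) label_graph \<Rightarrow> ('v, 'l) pvec \<Rightarrow> ('v \<Rightarrow> 'l) \<Rightarrow> 'v set" where
  "persistent_variables G \<theta> x\<^sub>0 =
     \<Union>{A. A \<subseteq> nodes G \<and> relaxed_criterion G \<theta> x\<^sub>0 A \<and>
            strongly_persistent G \<theta> A (restrict x\<^sub>0 A)}"

definition test_reparam ::
    "('v, 'l) pvec \<Rightarrow> ('v \<Rightarrow> 'l) \<Rightarrow> 'v \<Rightarrow> 'v \<Rightarrow> 'l \<Rightarrow> real" where
  "test_reparam \<theta> x\<^sub>0 v u a = - pairwise \<theta> u v (x\<^sub>0 u) a"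

end

theory Submission
  imports Defs
begin

text \<open>
  Reparametrizing by \<open>\<psi>\<close> leaves the energy inside \<open>A\<close> unchanged and replaces the term that a
  boundary edge \<open>uv\<close> adds to \<open>u\<close> by the maximum (at the test label) or the minimum (elsewhere) over
  \<open>x\<^sub>v\<close> of the difference \<open>\<theta>\<^sub>u\<^sub>v(x\<^sub>u, x\<^sub>v) - \<theta>\<^sub>u\<^sub>v(x\<^sup>0\<^sub>u, x\<^sub>v)\<close>. At \<open>x\<^sup>0\<^sub>u\<close> this is zero, and elsewhere it is at
  least the original gap \<open>min \<theta>\<^sub>u\<^sub>v(x\<^sub>u, \<cdot>) - max \<theta>\<^sub>u\<^sub>v(x\<^sup>0\<^sub>u, \<cdot>)\<close>; hence the relaxed criterion is inherited.
  If some labeling \<open>x'\<close> is optimal for its own reparametrized problem, then its optimality and that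
  of \<open>x\<^sup>0\<close> force equality in all these estimates. So \<open>\<theta>\<^sub>u\<^sub>v(x'\<^sub>u, \<cdot>)\<close> and \<open>\<theta>\<^sub>u\<^sub>v(x\<^sup>0\<^sub>u, \<cdot>)\<close> are constant
  on every boundary edge where \<open>x'\<close> and \<open>x\<^sup>0\<close> differ, the original problems for \<open>x'\<close> and for \<open>x\<^sup>0\<close>
  coincide, and strong persistence of \<open>x\<^sup>0\<close> gives \<open>x' = x\<^sup>0\<close>.
\<close>

section \<open>Finiteness of edge sets and nonemptiness of label sets\<close>

lemma wf_label_graphD:
  assumes "wf_label_graph G"
  shows "finite (nodes G)" "finite (edges G)" "edges G \<subseteq> nodes G \<times> nodes G" "sym (edges G)"
    "\<And>v. v \<in> nodes G \<Longrightarrow> finite (labels G v)"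
  using assms finite_subset[of "edges G" "nodes G \<times> nodes G"] by (auto simp: wf_label_graph_def)

lemma finite_inner_boundary:
  assumes "wf_label_graph G"
  shows "finite (inner_edges G A)" "finite (boundary_edges G A)"
  using wf_label_graphD(2)[OF assms]
  by (auto simp: inner_edges_def boundary_edges_def intro: finite_subset[of _ "edges G"])

lemma boundary_edgesD:
  assumes "wf_label_graph G" "(u, v) \<in> boundary_edges G A"
  shows "u \<in> A" "u \<in> nodes G" "v \<in> nodes G"
  using assms wf_label_graphD(3)[OF assms(1)] by (auto simp: boundary_edges_def)

lemma labelings_nonempty:
  assumes "x \<in> labelings G A" "v \<in> A"
  shows "labels G v \<noteq> {}"
  using assms by (auto simp: labelings_def PiE_def Pi_def)

lemma restrict_labelings:
  assumes "x \<in> labelings G B" "A \<subseteq> B"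
  shows "restrict x A \<in> labelings G A"
  using assms by (auto simp: labelings_def PiE_def Pi_def)

section \<open>Effect of a reparametrization on the relaxed energy\<close>

lemma sum_outgoing_edges:
  fixes f :: "'v \<Rightarrow> 'v \<Rightarrow> real"
  assumes wf: "wf_label_graph G" and A: "A \<subseteq> nodes G"
  shows "(\<Sum>u\<in>A. \<Sum>v | (v, u) \<in> edges G. f u v) =
    (\<Sum>(u, v)\<in>inner_edges G A. f u v) + (\<Sum>(u, v)\<in>boundary_edges G A. f u v)"
proof -
  have fin: "finite A" "\<And>u. finite {v. (v, u) \<in> edges G}"
    using wf_label_graphD[OF wf] A finite_subset
    by (auto intro: finite_subset[of A] finite_subset[of "{v. (v, u) \<in> edges G}" "nodes G" for u])
  \<comment> \<open>Symmetry turns the arcs \<open>(v, u)\<close> entering a node of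
    \<open>A\<close> into arcs leaving it, whose far end lies inside or outside
    \<open>A\<close>.\<close>
  have split: "Sigma A (\<lambda>u. {v. (v, u) \<in> edges G}) = inner_edges G A \<union> boundary_edges G A"
    using wf_label_graphD(3,4)[OF wf]
    by (auto simp: inner_edges_def boundary_edges_def dest: symD)
  have "(\<Sum>u\<in>A. \<Sum>v | (v, u) \<in> edges G. f u v) =
      (\<Sum>(u, v)\<in>inner_edges G A \<union> boundary_edges G A. f u v)"
    using fin by (simp add: sum.Sigma flip: split)
  also have "\<dots> = (\<Sum>(u, v)\<in>inner_edges G A. f u v) + (\<Sum>(u, v)\<in>boundary_edges G A. f u v)"
    by (rule sum.union_disjoint) (auto simp: finite_inner_boundary[OF wf],
      auto simp: inner_edges_def boundary_edges_def)
  finally show ?thesis .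
qed

lemma sum_inner_edges_swap:
  assumes "wf_label_graph G"
  shows "(\<Sum>(u, v)\<in>inner_edges G A. f v u) = (\<Sum>(u, v)\<in>inner_edges G A. f u v)"
  by (rule sum.reindex_bij_witness[of _ prod.swap prod.swap])
    (use wf_label_graphD(4)[OF assms] in \<open>auto simp: inner_edges_def dest: symD\<close>)

text \<open>Marginalization turns the pairwise shifts on an inner edge into unary ones. Both
  orientations together, halved, cancel the inner part of the unary shift; a boundary edge has no
  pairwise term in \<open>A\<close>, so its unary shift survives.\<close>

lemma relaxed_energy_reparametrize:
  assumes wf: "wf_label_graph G" and A: "A \<subseteq> nodes G" and \<mu>: "\<mu> \<in> local_polytope G A"
  shows "relaxed_energy G (reparametrize G \<phi> \<theta>) A \<mu> = relaxed_energy G \<theta> A \<mu> -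
    (\<Sum>(u, v)\<in>boundary_edges G A. \<Sum>a\<in>labels G u. \<phi> u v a * unary \<mu> u a)"
proof -
  define F where "F u v = (\<Sum>a\<in>labels G u. \<phi> u v a * unary \<mu> u a)" for u v
  have pair: "(\<Sum>a\<in>labels G u. \<Sum>b\<in>labels G v.
        pairwise (reparametrize G \<phi> \<theta>) u v a b * pairwise \<mu> u v a b) =
      (\<Sum>a\<in>labels G u. \<Sum>b\<in>labels G v. pairwise \<theta> u v a b * pairwise \<mu> u v a b) + (F v u + F u v)"
    if "(u, v) \<in> inner_edges G A" for u v
  proof -
    have m: "\<And>a. a \<in> labels G u \<Longrightarrow> (\<Sum>b\<in>labels G v. pairwise \<mu> u v a b) = unary \<mu> u a"
      "\<And>b. b \<in> labels G v \<Longrightarrow> (\<Sum>a\<in>labels G u. pairwise \<mu> u v a b) = unary \<mu> v b"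
      using \<mu> that by (auto simp: local_polytope_def)
    have "(\<Sum>a\<in>labels G u. \<Sum>b\<in>labels G v. \<phi> v u b * pairwise \<mu> u v a b) = F v u"
      by (subst sum.swap) (simp add: F_def m flip: sum_distrib_left)
    moreover have "(\<Sum>a\<in>labels G u. \<Sum>b\<in>labels G v. \<phi> u v a * pairwise \<mu> u v a b) = F u v"
      by (simp add: F_def m flip: sum_distrib_left)
    ultimately show ?thesis
      by (simp add: reparametrize_def distrib_right sum.distrib)
  qed
  have "(\<Sum>u\<in>A. \<Sum>a\<in>labels G u. (\<Sum>v | (v, u) \<in> edges G. \<phi> u v a) * unary \<mu> u a) =
      (\<Sum>u\<in>A. \<Sum>v | (v, u) \<in> edges G. F u v)"
    unfolding F_def sum_distrib_right by (intro sum.cong refl sum.swap)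
  then have un: "(\<Sum>u\<in>A. \<Sum>a\<in>labels G u. unary (reparametrize G \<phi> \<theta>) u a * unary \<mu> u a) =
      (\<Sum>u\<in>A. \<Sum>a\<in>labels G u. unary \<theta> u a * unary \<mu> u a) -
      ((\<Sum>(u, v)\<in>inner_edges G A. F u v) + (\<Sum>(u, v)\<in>boundary_edges G A. F u v))"
    by (simp add: sum_outgoing_edges[OF wf A] reparametrize_def left_diff_distrib sum_subtractf)
  have "(\<Sum>(u, v)\<in>inner_edges G A. \<Sum>a\<in>labels G u. \<Sum>b\<in>labels G v.
        pairwise (reparametrize G \<phi> \<theta>) u v a b * pairwise \<mu> u v a b) =
      (\<Sum>(u, v)\<in>inner_edges G A.
        (\<Sum>a\<in>labels G u. \<Sum>b\<in>labels G v. pairwise \<theta> u v a b * pairwise \<mu> u v a b) + (F v u + F u v))"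
    by (rule sum.cong[OF refl]) (clarify, rule pair)
  also have "\<dots> = (\<Sum>(u, v)\<in>inner_edges G A. \<Sum>a\<in>labels G u. \<Sum>b\<in>labels G v.
        pairwise \<theta> u v a b * pairwise \<mu> u v a b) +
      ((\<Sum>(u, v)\<in>inner_edges G A. F v u) + (\<Sum>(u, v)\<in>inner_edges G A. F u v))"
    by (simp add: case_prod_unfold sum.distrib)
  finally show ?thesis
    unfolding relaxed_energy_def un
    by (simp add: sum_inner_edges_swap[OF wf, of F] add_divide_distrib flip: F_def)
qed

section \<open>Labelings as integral points of the local polytope\<close>

lemma sum_label_indicator:
  fixes f :: "'l \<Rightarrow> real"
  assumes "finite L" "c \<in> L"
  shows "(\<Sum>a\<in>L. f a * of_bool (c = a)) = f c"
  using assms by (simp add: of_bool_def if_distrib cong: if_cong)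

lemma indicator_vec_in_local_polytope:
  assumes wf: "wf_label_graph G" and A: "A \<subseteq> nodes G" and x: "x \<in> labelings G A"
  shows "indicator_vec x \<in> local_polytope G A"
proof -
  have L: "finite (labels G v)" "x v \<in> labels G v" if "v \<in> A" for v
    using that A x wf_label_graphD(5)[OF wf] by (auto simp: labelings_def)
  show ?thesis
    using L
    by (auto simp: local_polytope_def indicator_vec_def orientation_invariant_def inner_edges_def
        of_bool_def if_distrib cong: if_cong)
qed

lemma relaxed_energy_indicator_vec:
  assumes wf: "wf_label_graph G" and A: "A \<subseteq> nodes G" and x: "x \<in> labelings G A"
  shows "relaxed_energy G \<theta> A (indicator_vec x) = energy G \<theta> A x"
proof -
  have L: "finite (labels G v)" "x v \<in> labels G v" if "v \<in> A" for v
    using that A x wf_label_graphD(5)[OF wf] by (auto simp: labelings_def)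
  have "(\<Sum>a\<in>labels G u. \<Sum>b\<in>labels G v. pairwise \<theta> u v a b * of_bool (x u = a \<and> x v = b)) =
      pairwise \<theta> u v (x u) (x v)" if "u \<in> A" "v \<in> A" for u v
    using L[OF that(1)] L[OF that(2)]
    by (simp add: of_bool_conj sum_label_indicator mult.assoc[symmetric] mult.commute[of "of_bool (x u = _)"]
        flip: sum_distrib_left sum_distrib_right)
  then show ?thesis
    using L
    by (auto simp: relaxed_energy_def energy_def indicator_vec_def inner_edges_def sum_label_indicator
        intro!: arg_cong2[of _ _ _ _ "(+)"] arg_cong2[of _ _ _ _ "(/)"] sum.cong)
qed

lemma sum_boundary_indicator_vec:
  assumes wf: "wf_label_graph G" and A: "A \<subseteq> nodes G" and x: "x \<in> labelings G A"
  shows "(\<Sum>(u, v)\<in>boundary_edges G A. \<Sum>a\<in>labels G u. f u v a * unary (indicator_vec x) u a) =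
    (\<Sum>(u, v)\<in>boundary_edges G A. f u v (x u))"
proof (rule sum.cong[OF refl], clarify)
  fix u v assume "(u, v) \<in> boundary_edges G A"
  then have "finite (labels G u)" "x u \<in> labels G u"
    using boundary_edgesD[OF wf] wf_label_graphD(5)[OF wf] x by (auto simp: labelings_def)
  then show "(\<Sum>a\<in>labels G u. f u v a * unary (indicator_vec x) u a) = f u v (x u)"
    using sum_label_indicator by (simp add: indicator_vec_def del: sum_mult_of_bool_eq)
qed

lemma relaxed_energy_hat_indicator_vec:
  assumes "wf_label_graph G" "A \<subseteq> nodes G" "x \<in> labelings G A"
  shows "relaxed_energy_hat G \<theta> A y (indicator_vec x) = energy_hat G \<theta> A y x"
  using sum_boundary_indicator_vec[OF assms, of "\<lambda>u v. theta_hat G \<theta> u v (y u)"]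
  by (simp add: relaxed_energy_hat_def energy_hat_def relaxed_energy_indicator_vec[OF assms])

section \<open>Boundary terms and energies under the special reparametrization\<close>

definition gap_hat ::
    "('v, 'l) label_graph \<Rightarrow> ('v, 'l) pvec \<Rightarrow> ('v \<Rightarrow> 'l) \<Rightarrow> 'v \<Rightarrow> 'v \<Rightarrow> 'l \<Rightarrow> 'l \<Rightarrow> real" where
  "gap_hat G \<theta> x\<^sub>0 u v c a =
     (if a = c then Max ((\<lambda>b. pairwise \<theta> u v a b - pairwise \<theta> u v (x\<^sub>0 u) b) ` labels G v)
      else Min ((\<lambda>b. pairwise \<theta> u v a b - pairwise \<theta> u v (x\<^sub>0 u) b) ` labels G v))"

text \<open>Of the two shifts on the edge, the one at the outer end \<open>v\<close> produces the
  difference inside \<open>gap_hat\<close>; the one at \<open>u\<close> does not depend on the outer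
  label and comes out of Max and Min. The tested label \<open>c\<close> is kept apart from
  \<open>x\<^sub>0 u\<close> because other labelings are later tested against themselves.\<close>

lemma theta_hat_test_reparam:
  assumes "finite (labels G v)" "labels G v \<noteq> {}"
  shows "theta_hat G (reparametrize G (test_reparam \<theta> x\<^sub>0) \<theta>) u v c a =
    gap_hat G \<theta> x\<^sub>0 u v c a + test_reparam \<theta> x\<^sub>0 u v a"
  using Max_add_commute[OF assms, of "\<lambda>b. pairwise \<theta> u v a b - pairwise \<theta> u v (x\<^sub>0 u) b" "- pairwise \<theta> v u (x\<^sub>0 v) a"]
    Min_add_commute[OF assms, of "\<lambda>b. pairwise \<theta> u v a b - pairwise \<theta> u v (x\<^sub>0 u) b" "- pairwise \<theta> v u (x\<^sub>0 v) a"]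
  by (auto simp: theta_hat_def gap_hat_def reparametrize_def test_reparam_def)

lemma gap_hat_test_label:
  assumes "labels G v \<noteq> {}"
  shows "gap_hat G \<theta> x\<^sub>0 u v c (x\<^sub>0 u) = 0"
  using assms by (simp add: gap_hat_def image_constant_conv)

text \<open>For a fixed outer label the difference is at least the minimum of one row minus the
  maximum of the other. Max and Min over the outer label both inherit this bound, so
  \<open>c\<close> may be arbitrary. At the test label both sides are zero.\<close>

lemma theta_hat_gap_le_gap_hat:
  assumes "finite (labels G v)" "labels G v \<noteq> {}"
  shows "theta_hat G \<theta> u v (x\<^sub>0 u) a - theta_hat G \<theta> u v (x\<^sub>0 u) (x\<^sub>0 u) \<le> gap_hat G \<theta> x\<^sub>0 u v c a"
proof (cases "a = x\<^sub>0 u")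
  case True
  then show ?thesis using gap_hat_test_label[OF assms(2)] by simp
next
  case False
  have le: "theta_hat G \<theta> u v (x\<^sub>0 u) a - theta_hat G \<theta> u v (x\<^sub>0 u) (x\<^sub>0 u) \<le>
      pairwise \<theta> u v a b - pairwise \<theta> u v (x\<^sub>0 u) b" if "b \<in> labels G v" for b
    using that assms False by (auto simp: theta_hat_def intro!: diff_mono)
  show ?thesis
    using assms le by (auto simp: gap_hat_def Max_ge_iff Min_ge_iff)
qed

text \<open>Equality in the preceding estimate makes the pairwise potential constant on both labels.\<close>

lemma theta_hat_eq_if_gap_eq:
  assumes L: "finite (labels G v)" "labels G v \<noteq> {}"
    and eq: "theta_hat G \<theta> u v (x\<^sub>0 u) c - theta_hat G \<theta> u v (x\<^sub>0 u) (x\<^sub>0 u) = gap_hat G \<theta> x\<^sub>0 u v c c"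
  shows "theta_hat G \<theta> u v c a = theta_hat G \<theta> u v (x\<^sub>0 u) a"
proof (cases "c = x\<^sub>0 u")
  case False
  let ?m = "Min (pairwise \<theta> u v c ` labels G v)" and ?M = "Max (pairwise \<theta> u v (x\<^sub>0 u) ` labels G v)"
  \<comment> \<open>Here label and tested label coincide, so \<open>gap_hat\<close> is a maximum and
    the assumed equality bounds every difference from above by \<open>?m - ?M\<close>. This is also
    a lower bound, which forces both rows to be constant.\<close>
  have "pairwise \<theta> u v c b = ?m \<and> pairwise \<theta> u v (x\<^sub>0 u) b = ?M" if b: "b \<in> labels G v" for b
  proof -
    have "pairwise \<theta> u v c b - pairwise \<theta> u v (x\<^sub>0 u) b \<le> gap_hat G \<theta> x\<^sub>0 u v c c"
      using b L by (simp add: gap_hat_def)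
    also have "\<dots> = ?m - ?M"
      using eq False by (simp add: theta_hat_def)
    finally have "pairwise \<theta> u v c b - pairwise \<theta> u v (x\<^sub>0 u) b \<le> ?m - ?M" .
    moreover have "?m \<le> pairwise \<theta> u v c b" "pairwise \<theta> u v (x\<^sub>0 u) b \<le> ?M"
      using b L by simp_all
    ultimately show ?thesis by linarith
  qed
  then have "pairwise \<theta> u v c ` labels G v = {?m}" "pairwise \<theta> u v (x\<^sub>0 u) ` labels G v = {?M}"
    using L(2) by force+
  then have "Max (pairwise \<theta> u v c ` labels G v) = ?m"
    "Min (pairwise \<theta> u v (x\<^sub>0 u) ` labels G v) = ?M"
    by (metis Max_singleton) (metis \<open>pairwise \<theta> u v (x\<^sub>0 u) ` labels G v = {?M}\<close> Min_singleton)
  \<comment> \<open>The two hats can differ only at \<open>a = c\<close> and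
    \<open>a = x\<^sub>0 u\<close>, where one takes the maximum and the other the minimum of a
    constant row.\<close>
  then show ?thesis
    using False by (simp add: theta_hat_def)
qed simp

text \<open>The shift \<open>test_reparam \<theta> x\<^sub>0 u v a\<close> split off from
  \<open>theta_hat\<close> cancels the boundary residue of
  \<open>relaxed_energy_reparametrize\<close>.\<close>

lemma relaxed_energy_hat_test_reparam:
  assumes wf: "wf_label_graph G" and A: "A \<subseteq> nodes G" and \<mu>: "\<mu> \<in> local_polytope G A"
    and L: "\<And>v. v \<in> nodes G \<Longrightarrow> labels G v \<noteq> {}"
  shows "relaxed_energy_hat G (reparametrize G (test_reparam \<theta> x\<^sub>0) \<theta>) A y \<mu> =
    relaxed_energy G \<theta> A \<mu> +
    (\<Sum>(u, v)\<in>boundary_edges G A. \<Sum>a\<in>labels G u. gap_hat G \<theta> x\<^sub>0 u v (y u) a * unary \<mu> u a)"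
proof -
  have "(\<Sum>(u, v)\<in>boundary_edges G A. \<Sum>a\<in>labels G u.
        theta_hat G (reparametrize G (test_reparam \<theta> x\<^sub>0) \<theta>) u v (y u) a * unary \<mu> u a) =
      (\<Sum>(u, v)\<in>boundary_edges G A.
        (\<Sum>a\<in>labels G u. gap_hat G \<theta> x\<^sub>0 u v (y u) a * unary \<mu> u a) +
        (\<Sum>a\<in>labels G u. test_reparam \<theta> x\<^sub>0 u v a * unary \<mu> u a))"
    using boundary_edgesD[OF wf] wf_label_graphD(5)[OF wf] L
    by (intro sum.cong refl)
      (auto simp: theta_hat_test_reparam distrib_right sum.distrib)
  then show ?thesis
    by (simp add: relaxed_energy_hat_def relaxed_energy_reparametrize[OF wf A \<mu>]
        case_prod_unfold sum.distrib)
qed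

lemma energy_hat_test_reparam:
  assumes wf: "wf_label_graph G" and A: "A \<subseteq> nodes G" and x: "x \<in> labelings G A"
    and L: "\<And>v. v \<in> nodes G \<Longrightarrow> labels G v \<noteq> {}"
  shows "energy_hat G (reparametrize G (test_reparam \<theta> x\<^sub>0) \<theta>) A y x =
    energy G \<theta> A x + (\<Sum>(u, v)\<in>boundary_edges G A. gap_hat G \<theta> x\<^sub>0 u v (y u) (x u))"
  using relaxed_energy_hat_test_reparam[OF wf A indicator_vec_in_local_polytope[OF wf A x] L]
    sum_boundary_indicator_vec[OF wf A x, of "\<lambda>u v. gap_hat G \<theta> x\<^sub>0 u v (y u)"]
  by (simp add: relaxed_energy_hat_indicator_vec[OF wf A x] relaxed_energy_indicator_vec[OF wf A x])

text \<open>All gaps vanish at the labels of \<open>x\<^sub>0\<close>, whatever \<open>y\<close> is.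
  So \<open>x\<^sub>0\<close> has the same value in every test problem, which makes it comparable
  with a labeling tested against itself.\<close>

lemma energy_hat_test_reparam_test_labeling:
  assumes wf: "wf_label_graph G" and A: "A \<subseteq> nodes G" and x\<^sub>0: "x\<^sub>0 \<in> labelings G (nodes G)"
  shows "energy_hat G (reparametrize G (test_reparam \<theta> x\<^sub>0) \<theta>) A y (restrict x\<^sub>0 A) =
    energy G \<theta> A (restrict x\<^sub>0 A)"
proof -
  have "gap_hat G \<theta> x\<^sub>0 u v (y u) (restrict x\<^sub>0 A u) = 0" if "(u, v) \<in> boundary_edges G A" for u v
    using boundary_edgesD[OF wf that] labelings_nonempty[OF x\<^sub>0] by (simp add: gap_hat_test_label)
  then have "(\<Sum>(u, v)\<in>boundary_edges G A. gap_hat G \<theta> x\<^sub>0 u v (y u) (restrict x\<^sub>0 A u)) = 0"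
    by (intro sum.neutral) auto
  moreover have "energy_hat G (reparametrize G (test_reparam \<theta> x\<^sub>0) \<theta>) A y (restrict x\<^sub>0 A) =
      energy G \<theta> A (restrict x\<^sub>0 A) +
      (\<Sum>(u, v)\<in>boundary_edges G A. gap_hat G \<theta> x\<^sub>0 u v (y u) (restrict x\<^sub>0 A u))"
    by (rule energy_hat_test_reparam[OF wf A restrict_labelings[OF x\<^sub>0 A]])
      (rule labelings_nonempty[OF x\<^sub>0])
  ultimately show ?thesis by linarith
qed

section \<open>Inheritance of the relaxed criterion and of strong persistence\<close>

lemma relaxed_criterion_test_reparam:
  assumes wf: "wf_label_graph G" and A: "A \<subseteq> nodes G" and x\<^sub>0: "x\<^sub>0 \<in> labelings G (nodes G)"
    and crit: "relaxed_criterion G \<theta> x\<^sub>0 A"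
  shows "relaxed_criterion G (reparametrize G (test_reparam \<theta> x\<^sub>0) \<theta>) x\<^sub>0 A"
proof -
  let ?x = "restrict x\<^sub>0 A" and ?\<psi> = "reparametrize G (test_reparam \<theta> x\<^sub>0) \<theta>"
  have L: "finite (labels G v)" "labels G v \<noteq> {}" if "v \<in> nodes G" for v
    using wf_label_graphD(5)[OF wf that] labelings_nonempty[OF x\<^sub>0 that] .
  have x: "?x \<in> labelings G A" by (rule restrict_labelings[OF x\<^sub>0 A])
  note bd = boundary_edgesD[OF wf]
  define h where "h u v a = theta_hat G \<theta> u v (x\<^sub>0 u) a" for u v a
  have hx: "theta_hat G \<theta> u v (?x u) a = h u v a" if "(u, v) \<in> boundary_edges G A" for u v a
    using bd[OF that] by (simp add: h_def)
  \<comment> \<open>\<open>?c\<close> is the original boundary cost of the test labeling.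
    Reparametrizing lowers the value at the test labeling by exactly \<open>?c\<close> and the value
    at any \<open>\<mu>\<close> by at most \<open>?c\<close>.\<close>
  let ?c = "\<Sum>(u, v)\<in>boundary_edges G A. h u v (x\<^sub>0 u)"
  have "relaxed_energy_hat G ?\<psi> A ?x (indicator_vec ?x) \<le> relaxed_energy_hat G ?\<psi> A ?x \<mu>"
    if \<mu>: "\<mu> \<in> local_polytope G A" for \<mu>
  proof -
    have \<mu>1: "unary \<mu> u a \<ge> 0" "(\<Sum>a\<in>labels G u. unary \<mu> u a) = 1"
      if "u \<in> A" "a \<in> labels G u" for u a
      using \<mu> that by (auto simp: local_polytope_def)
    have "energy_hat G \<theta> A ?x ?x = energy G \<theta> A ?x + ?c"
      unfolding energy_hat_def
      using bd hx by (intro arg_cong2[of _ _ _ _ "(+)"] sum.cong refl) auto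
    then have "energy_hat G ?\<psi> A ?x ?x = energy_hat G \<theta> A ?x ?x - ?c"
      by (simp add: energy_hat_test_reparam_test_labeling[OF wf A x\<^sub>0])
    also have "energy_hat G \<theta> A ?x ?x \<le> relaxed_energy_hat G \<theta> A ?x \<mu>"
      using crit \<mu> unfolding relaxed_criterion_def is_arg_min_linorder
      by (simp add: relaxed_energy_hat_indicator_vec[OF wf A x])
    also have "relaxed_energy_hat G \<theta> A ?x \<mu> - ?c = relaxed_energy G \<theta> A \<mu> +
        (\<Sum>(u, v)\<in>boundary_edges G A. (\<Sum>a\<in>labels G u. h u v a * unary \<mu> u a) - h u v (x\<^sub>0 u))"
      using hx by (simp add: relaxed_energy_hat_def case_prod_unfold sum_subtractf)
    also have "\<dots> \<le> relaxed_energy G \<theta> A \<mu> + (\<Sum>(u, v)\<in>boundary_edges G A.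
        \<Sum>a\<in>labels G u. gap_hat G \<theta> x\<^sub>0 u v (?x u) a * unary \<mu> u a)"
    proof (intro add_left_mono sum_mono, clarify)
      fix u v assume uv: "(u, v) \<in> boundary_edges G A"
      \<comment> \<open>The label \<open>l\<close> instantiates \<open>\<mu>1(2)\<close>.
        Normalization then spreads the constant \<open>h u v (x\<^sub>0 u)\<close> over all labels,
        and the gap estimate applies label by label with nonnegative weights.\<close>
      obtain l where "l \<in> labels G u" using L bd[OF uv] by blast
      then have "(\<Sum>a\<in>labels G u. h u v a * unary \<mu> u a) - h u v (x\<^sub>0 u) =
          (\<Sum>a\<in>labels G u. (h u v a - h u v (x\<^sub>0 u)) * unary \<mu> u a)"
        using \<mu>1(2)[OF bd(1)[OF uv]]
        by (simp add: left_diff_distrib sum_subtractf flip: sum_distrib_left)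
      also have "\<dots> \<le> (\<Sum>a\<in>labels G u. gap_hat G \<theta> x\<^sub>0 u v (?x u) a * unary \<mu> u a)"
        using theta_hat_gap_le_gap_hat[OF L[OF bd(3)[OF uv]]] \<mu>1(1)[OF bd(1)[OF uv]]
        unfolding h_def by (intro sum_mono mult_right_mono)
      finally show "(\<Sum>a\<in>labels G u. h u v a * unary \<mu> u a) - h u v (x\<^sub>0 u) \<le>
          (\<Sum>a\<in>labels G u. gap_hat G \<theta> x\<^sub>0 u v (?x u) a * unary \<mu> u a)" .
    qed
    also have "\<dots> = relaxed_energy_hat G ?\<psi> A ?x \<mu>"
      by (simp add: relaxed_energy_hat_test_reparam[OF wf A \<mu> L(2)])
    finally show ?thesis by (simp add: relaxed_energy_hat_indicator_vec[OF wf A x])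
  qed
  then show ?thesis
    by (simp add: relaxed_criterion_def is_arg_min_linorder indicator_vec_in_local_polytope[OF wf A x])
qed

text \<open>Labelings are points of the polytope with the same energy, so an integral minimizer of
  the relaxation also minimizes over labelings.\<close>

lemma relaxed_criterion_imp_is_arg_min:
  assumes wf: "wf_label_graph G" and A: "A \<subseteq> nodes G" and x\<^sub>0: "x\<^sub>0 \<in> labelings G (nodes G)"
    and crit: "relaxed_criterion G \<theta> x\<^sub>0 A"
  shows "is_arg_min (energy_hat G \<theta> A (restrict x\<^sub>0 A)) (\<lambda>z. z \<in> labelings G A) (restrict x\<^sub>0 A)"
  using crit restrict_labelings[OF x\<^sub>0 A] indicator_vec_in_local_polytope[OF wf A]
  unfolding relaxed_criterion_def is_arg_min_linorder
  by (metis relaxed_energy_hat_indicator_vec[OF wf A])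

lemma strongly_persistent_test_reparam:
  assumes wf: "wf_label_graph G" and A: "A \<subseteq> nodes G" and x\<^sub>0: "x\<^sub>0 \<in> labelings G (nodes G)"
    and crit: "relaxed_criterion G \<theta> x\<^sub>0 A"
    and pers: "strongly_persistent G \<theta> A (restrict x\<^sub>0 A)"
  shows "strongly_persistent G (reparametrize G (test_reparam \<theta> x\<^sub>0) \<theta>) A (restrict x\<^sub>0 A)"
proof -
  let ?x = "restrict x\<^sub>0 A" and ?\<psi> = "reparametrize G (test_reparam \<theta> x\<^sub>0) \<theta>"
  let ?B = "boundary_edges G A"
  have L: "finite (labels G v)" "labels G v \<noteq> {}" if "v \<in> nodes G" for v
    using wf_label_graphD(5)[OF wf that] labelings_nonempty[OF x\<^sub>0 that] .
  have x: "?x \<in> labelings G A" by (rule restrict_labelings[OF x\<^sub>0 A])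
  note bd = boundary_edgesD[OF wf]
  have "x' = ?x" if self: "is_arg_min (energy_hat G ?\<psi> A x') (\<lambda>z. z \<in> labelings G A) x'" for x'
  proof -
    have x': "x' \<in> labelings G A" using self by (simp add: is_arg_min_def)
    \<comment> \<open>\<open>g\<close> is the boundary cost of \<open>x'\<close> in its own
      reparametrized problem, after cancellation of the shifts; \<open>d\<close> is the change of
      boundary cost from \<open>x\<^sub>0\<close> to \<open>x'\<close> in the original problem
      tested by \<open>x\<^sub>0\<close>.\<close>
    define g where "g u v = gap_hat G \<theta> x\<^sub>0 u v (x' u) (x' u)" for u v
    define d where "d u v = theta_hat G \<theta> u v (x\<^sub>0 u) (x' u) - theta_hat G \<theta> u v (x\<^sub>0 u) (x\<^sub>0 u)" for u v
    have "energy G \<theta> A x' + (\<Sum>(u, v)\<in>?B. g u v) = energy_hat G ?\<psi> A x' x'"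
      by (simp add: energy_hat_test_reparam[OF wf A x' L(2)] g_def)
    also have "\<dots> \<le> energy_hat G ?\<psi> A x' ?x"
      using self x by (simp add: is_arg_min_linorder)
    finally have le1: "energy G \<theta> A x' + (\<Sum>(u, v)\<in>?B. g u v) \<le> energy G \<theta> A ?x"
      by (simp add: energy_hat_test_reparam_test_labeling[OF wf A x\<^sub>0])
    have "energy_hat G \<theta> A ?x x' - energy_hat G \<theta> A ?x ?x =
        energy G \<theta> A x' - energy G \<theta> A ?x +
        (\<Sum>(u, v)\<in>?B. theta_hat G \<theta> u v (?x u) (x' u) - theta_hat G \<theta> u v (?x u) (?x u))"
      by (simp add: energy_hat_def case_prod_unfold sum_subtractf)
    also have "(\<Sum>(u, v)\<in>?B. theta_hat G \<theta> u v (?x u) (x' u) - theta_hat G \<theta> u v (?x u) (?x u)) =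
        (\<Sum>(u, v)\<in>?B. d u v)"
      using bd by (intro sum.cong refl) (auto simp: d_def)
    finally have diff: "energy_hat G \<theta> A ?x x' - energy_hat G \<theta> A ?x ?x =
        energy G \<theta> A x' - energy G \<theta> A ?x + (\<Sum>(u, v)\<in>?B. d u v)" .
    have opt: "energy_hat G \<theta> A ?x ?x \<le> energy_hat G \<theta> A ?x z" if "z \<in> labelings G A" for z
      using relaxed_criterion_imp_is_arg_min[OF wf A x\<^sub>0 crit] that by (simp add: is_arg_min_linorder)
    have dg: "d u v \<le> g u v" if "(u, v) \<in> ?B" for u v
      using theta_hat_gap_le_gap_hat[OF L[OF bd(3)[OF that]]] by (simp add: d_def g_def)
    then have "(\<Sum>(u, v)\<in>?B. d u v) \<le> (\<Sum>(u, v)\<in>?B. g u v)"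
      by (intro sum_mono) auto
    \<comment> \<open>With E the energy inside \<open>A\<close>, the chain E(x') + sum g \<le> E(x0)
      \<le> E(x') + sum d \<le> E(x') + sum g closes up, so equality holds throughout.\<close>
    with le1 diff opt[OF x'] have sum_eq: "(\<Sum>(u, v)\<in>?B. d u v) = (\<Sum>(u, v)\<in>?B. g u v)"
      and val_eq: "energy_hat G \<theta> A ?x x' = energy_hat G \<theta> A ?x ?x"
      by linarith+
    have "d u v = g u v" if "(u, v) \<in> ?B" for u v
      using sum_mono_inv[OF sum_eq _ that finite_inner_boundary(2)[OF wf]] dg by auto
    then have "theta_hat G \<theta> u v (x' u) a = theta_hat G \<theta> u v (?x u) a" if "(u, v) \<in> ?B" for u v a
      using theta_hat_eq_if_gap_eq[OF L[OF bd(3)[OF that]], of \<theta> u x\<^sub>0 "x' u" a] that bd(1)[OF that]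
      by (simp add: d_def g_def)
    \<comment> \<open>The problems tested by \<open>x'\<close> and by \<open>x\<^sub>0\<close> thus
      have the same objective, whose minimum \<open>x'\<close> attains by
      \<open>val_eq\<close>.\<close>
    then have "energy_hat G \<theta> A x' z = energy_hat G \<theta> A ?x z" for z
      unfolding energy_hat_def
      by (intro arg_cong2[of _ _ _ _ "(+)"] sum.cong refl) auto
    then have "is_arg_min (energy_hat G \<theta> A x') (\<lambda>z. z \<in> labelings G A) x'"
      using opt x' val_eq by (simp add: is_arg_min_linorder)
    then show ?thesis
      using pers by (simp add: strongly_persistent_def)
  qed
  \<comment> \<open>The argument above gives uniqueness; that \<open>x\<^sub>0\<close> is optimal
    for its own reparametrized problem comes from the inherited relaxed criterion.\<close>
  then show ?thesis
    unfolding strongly_persistent_def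
    using relaxed_criterion_imp_is_arg_min[OF wf A x\<^sub>0
        relaxed_criterion_test_reparam[OF wf A x\<^sub>0 crit]] by blast
qed

lemma reparametrize_zero [simp]: "reparametrize G (\<lambda>v u a. 0) \<theta> = \<theta>"
  by (simp add: reparametrize_def)

text \<open>The inclusion holds set by set: every node set contributing to the left union also
  contributes to the right one.\<close>

theorem theorem3:
  fixes G :: "('v, 'l) label_graph" and \<theta> :: "('v, 'l) pvec" and x\<^sub>0 :: "'v \<Rightarrow> 'l"
  assumes "wf_label_graph G"
    and "orientation_invariant G (nodes G) \<theta>"
    and "x\<^sub>0 \<in> labelings G (nodes G)"
  shows "persistent_variables G (reparametrize G (\<lambda>v u a. 0) \<theta>) x\<^sub>0
         \<subseteq> persistent_variables G (reparametrize G (test_reparam \<theta> x\<^sub>0) \<theta>) x\<^sub>0"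
  using relaxed_criterion_test_reparam[OF assms(1) _ assms(3)]
    strongly_persistent_test_reparam[OF assms(1) _ assms(3)]
  unfolding persistent_variables_def reparametrize_zero by blast

end
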